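(* There is an absolute constant $c>0$ such that, for all $n\ge2$, $\rho\in(0,1/2]$, $1\le m\le n-1$ and $s\in(0,1]$, $$\mathcal{E}^{\mathrm{REV}}_{m,s}\le \big(cn^2/(\rho s)\big)^m.$$
   Context: Fix $n\ge 2$ and $\rho\in(0,1/2]$. Let $(G_t)_{t\ge0}$ be undirected graphs on $[n]$, each with a self-loop at every vertex. A reversible averaging system is given by a fixed vector $q\in\mathbb{R}^n$ and, for each $t$, a symmetric nonnegative matrix $M_t$ with the following properties: - $(M_t)_{ij}\neq0$ if and only if $\{i,j\}$ is an edge of $G_t$ (diagonal included); - every nonzero entry of $M_t$ is at least $1$; - $M_t\mathbf{1}=q$ for all $t$; - $q_i\le 1/\rho$ for all $i$. Set $P_t=\mathrm{diag}(q)^{-1}M_t$ and $x(t+1)=P_tx(t)$. Blocks and the $s$-energy are defined as follows. At time $t$, each edge $\{i,j\}$ of $G_t$ with $i\ne j$ is embedded as the closed interval with endpoints $x_i(t)$ and $x_j(t)$. The union of these intervals is a disjoint union of closed intervals (blocks) with lengths $l_1(t),\dots,l_{k_t}(t)$. Then $E_{s,t}=\sum_i l_i(t)^s$ and $E_s=\sum_{t\ge0}E_{s,t}$ for $s\in(0,1]$. $\mathcal{E}^{\mathrm{REV}}_{m,s}$ is the supremum of $E_s$ over all reversible averaging systems (with the given $n,\rho$) in which every $G_t$ has at most $m$ connected components, and over all $x(0)$ with scaled variance $\sum_i q_i(x_i(0)-\mu)^2\le1$, where $\mu=\sum_iq_ix_i(0)/\sum_iq_i$. *)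

theory Defs
  imports "HOL-Analysis.Analysis"
begin

text \<open>Vertices are 0,...,n-1. A time-indexed family of matrices M t i j (only entries with
  i,j < n matter). The graph G_t has edge {i,j} iff M t i j \<noteq> 0 (diagonal included).\<close>

definition rev_system :: "nat \<Rightarrow> real \<Rightarrow> (nat \<Rightarrow> real) \<Rightarrow> (nat \<Rightarrow> nat \<Rightarrow> nat \<Rightarrow> real) \<Rightarrow> bool" where
  "rev_system n \<rho> q M \<longleftrightarrow>
     (\<forall>i<n. q i \<le> 1 / \<rho>) \<and>
     (\<forall>t. \<forall>i<n. \<forall>j<n. M t i j = M t j i \<and> 0 \<le> M t i j \<and> (M t i j \<noteq> 0 \<longrightarrow> 1 \<le> M t i j)) \<and>
     (\<forall>t. \<forall>i<n. M t i i \<noteq> 0) \<and>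
     (\<forall>t. \<forall>i<n. (\<Sum>j<n. M t i j) = q i)"

definition edge :: "nat \<Rightarrow> (nat \<Rightarrow> nat \<Rightarrow> nat \<Rightarrow> real) \<Rightarrow> nat \<Rightarrow> nat \<Rightarrow> nat \<Rightarrow> bool" where
  "edge n M t i j \<longleftrightarrow> i < n \<and> j < n \<and> M t i j \<noteq> 0"

definition num_components :: "nat \<Rightarrow> (nat \<Rightarrow> nat \<Rightarrow> nat \<Rightarrow> real) \<Rightarrow> nat \<Rightarrow> nat" where
  "num_components n M t = card ({..<n} // {(i, j). (edge n M t)\<^sup>*\<^sup>* i j})"

primrec traj :: "nat \<Rightarrow> (nat \<Rightarrow> real) \<Rightarrow> (nat \<Rightarrow> nat \<Rightarrow> nat \<Rightarrow> real) \<Rightarrow> (nat \<Rightarrow> real) \<Rightarrow> nat \<Rightarrow> nat \<Rightarrow> real" where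
  "traj n q M x0 0 = x0"
| "traj n q M x0 (Suc t) = (\<lambda>i. (\<Sum>j<n. M t i j * traj n q M x0 t j) / q i)"

definition edge_union :: "nat \<Rightarrow> (nat \<Rightarrow> nat \<Rightarrow> nat \<Rightarrow> real) \<Rightarrow> nat \<Rightarrow> (nat \<Rightarrow> real) \<Rightarrow> real set" where
  "edge_union n M t x = \<Union> {{min (x i) (x j) .. max (x i) (x j)} | i j. edge n M t i j \<and> i \<noteq> j}"

definition energy_t :: "nat \<Rightarrow> (nat \<Rightarrow> real) \<Rightarrow> (nat \<Rightarrow> nat \<Rightarrow> nat \<Rightarrow> real) \<Rightarrow> (nat \<Rightarrow> real) \<Rightarrow> real \<Rightarrow> nat \<Rightarrow> real" where
  "energy_t n q M x0 s t =
     (\<Sum>C\<in>components (edge_union n M t (traj n q M x0 t)). (Sup C - Inf C) powr s)"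

definition energy :: "nat \<Rightarrow> (nat \<Rightarrow> real) \<Rightarrow> (nat \<Rightarrow> nat \<Rightarrow> nat \<Rightarrow> real) \<Rightarrow> (nat \<Rightarrow> real) \<Rightarrow> real \<Rightarrow> ennreal" where
  "energy n q M x0 s = (\<Sum>t. ennreal (energy_t n q M x0 s t))"

definition scaled_variance :: "nat \<Rightarrow> (nat \<Rightarrow> real) \<Rightarrow> (nat \<Rightarrow> real) \<Rightarrow> real" where
  "scaled_variance n q x0 =
     (let \<mu> = (\<Sum>i<n. q i * x0 i) / (\<Sum>i<n. q i) in \<Sum>i<n. q i * (x0 i - \<mu>)\<^sup>2)"

definition E_REV :: "nat \<Rightarrow> real \<Rightarrow> nat \<Rightarrow> real \<Rightarrow> ennreal" where
  "E_REV n \<rho> m s = Sup {energy n q M x0 s | q M x0.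
      rev_system n \<rho> q M \<and> (\<forall>t. num_components n M t \<le> m) \<and> scaled_variance n q x0 \<le> 1}"

end

theory Submission
  imports Defs
begin

text \<open>
  Let \<open>S\<close> be a set of vertices without outgoing edges. For any fixed \<open>c\<close>, one step decreases the
  moment \<open>D = \<Sum>i\<in>S. q i * (x i - c)\<^sup>2\<close> by the sum over \<open>i\<close> of \<open>q i\<close> times the variance of \<open>x\<close>
  under the \<open>i\<close>-th row of \<open>P\<close>. As all nonzero weights, including the diagonal ones, are at least
  1, vertex \<open>i\<close> contributes at least \<open>(x j - x i)\<^sup>2 / 2\<close> for each neighbour \<open>j\<close>. Sort the positions
  at some time \<open>a\<close>: a gap between consecutive positions does not shrink until an edge crosses it,
  and at that moment half of its square is lost. Hence once all gaps of time \<open>a\<close> have been crossed,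
  Cauchy-Schwarz shows that \<open>D\<close> has lost at least \<open>\<Delta>\<^sup>2 / (2 * n)\<close>, where \<open>\<Delta>\<close> is the diameter, so
  it has shrunk by the factor \<open>1 - \<rho> / (2 * n\<^sup>2)\<close>. Until the last gap is crossed, the system
  decouples into two systems that have at least one component each, hence at most \<open>m - 1\<close>. Writing
  \<open>F m\<close> for the best constant in \<open>energy \<le> F m * D powr (s / 2)\<close>, this gives
  \<open>F m \<le> 2 * F (m - 1) + 2 * m + (1 - \<rho> * s / (4 * n\<^sup>2)) * F m\<close>, and
  \<open>(16 * n\<^sup>2 / (\<rho> * s)) ^ m\<close> solves this recursion.
\<close>

section \<open>Elementary inequalities and components on the real line\<close>

lemma bernoulli_powr_le:
  fixes d r :: real
  assumes "0 \<le> d" "d < 1" "0 \<le> r" "r \<le> 1"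
  shows "(1 - d) powr r \<le> 1 - r * d"
  \<comment> \<open>Weighted arithmetic-geometric mean inequality for \<open>1 - d\<close> and
    \<open>1\<close> with weights \<open>r\<close> and \<open>1 - r\<close>.\<close>
  using Youngs_inequality_0[of r "1 - r" "1 - d" 1] assms by (simp add: algebra_simps)

lemma sum_power2_le_power2_sum:
  fixes g :: "'a \<Rightarrow> real"
  assumes "finite I" "\<And>i. i \<in> I \<Longrightarrow> 0 \<le> g i"
  shows "(\<Sum>i\<in>I. (g i)\<^sup>2) \<le> (\<Sum>i\<in>I. g i)\<^sup>2"
proof -
  have "(\<Sum>i\<in>I. (g i)\<^sup>2) \<le> (\<Sum>i\<in>I. g i * sum g I)"
    using assms by (intro sum_mono) (auto simp: power2_eq_square intro!: mult_left_mono member_le_sum)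
  then show ?thesis by (simp add: power2_eq_square sum_distrib_right)
qed

lemma sum_increments_le:
  fixes y :: "nat \<Rightarrow> real"
  assumes "mono y" "finite I" "I \<noteq> {}"
  shows "(\<Sum>i\<in>I. y (Suc i) - y i) \<le> y (Suc (Max I)) - y (Min I)"
proof -
  have le: "Min I \<le> Max I" using assms by simp
  have "(\<Sum>i\<in>I. y (Suc i) - y i) \<le> (\<Sum>i\<in>{Min I..<Suc (Max I)}. y (Suc i) - y i)"
    using assms by (intro sum_mono2) (auto simp: monoD le_imp_less_Suc)
  also have "\<dots> = y (Suc (Max I)) - y (Min I)"
    using le by (intro sum_Suc_diff') simp
  finally show ?thesis .
qed

text \<open>A connected set meeting both parts would contain the midpoint of \<open>a\<close> and
  \<open>b\<close>, which lies in neither part. So each component lies on one side, where it remains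
  maximal.\<close>

lemma components_Un_separated_subset:
  fixes U W :: "real set"
  assumes "U \<subseteq> {..a}" "W \<subseteq> {b..}" "a < b"
  shows "components (U \<union> W) \<subseteq> components U \<union> components W"
proof
  fix C assume C: "C \<in> components (U \<union> W)"
  then have ne: "C \<noteq> {}" and con: "connected C" and sub: "C \<subseteq> U \<union> W"
    by (auto simp: in_components_nonempty in_components_connected in_components_subset)
  have maxi: "D = C" if "D \<noteq> {}" "C \<subseteq> D" "D \<subseteq> U \<union> W" "connected D" for D
    using C that by (meson in_components_maximal)
  have "C \<subseteq> U \<or> C \<subseteq> W"
  proof (rule ccontr)
    assume "\<not> ?thesis"
    then obtain u w where uw: "u \<in> C" "u \<in> U" "w \<in> C" "w \<in> W" using sub by blast
    have "u \<le> (a + b) / 2" "(a + b) / 2 \<le> w" using uw assms by force+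
    then have "(a + b) / 2 \<in> C" using con uw by (meson connectedD_interval)
    then show False using sub assms by force
  qed
  then show "C \<in> components U \<union> components W"
    using ne con maxi by (auto simp: in_components_maximal)
qed

lemma sum_Un_le:
  fixes f :: "'a \<Rightarrow> real"
  assumes "finite A" "finite B" "\<And>x. 0 \<le> f x" "C \<subseteq> A \<union> B"
  shows "sum f C \<le> sum f A + sum f B"
proof -
  have "sum f C \<le> sum f (A \<union> B)" using assms by (intro sum_mono2) auto
  also have "\<dots> \<le> sum f (A \<union> B) + sum f (A \<inter> B)" using assms by (simp add: sum_nonneg)
  also have "\<dots> = sum f A + sum f B" using assms by (simp add: sum.union_inter)
  finally show ?thesis .
qed

text \<open>For every \<open>c\<close>, the right-hand side equals the weighted sum of squared
  deviations from the mean \<open>m\<close>. For \<open>i \<noteq> k\<close> its two terms at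
  \<open>i\<close> and \<open>k\<close>, of weight at least 1 each, already dominate the left-hand
  side.\<close>

lemma weighted_variance_ge:
  fixes w z :: "'a \<Rightarrow> real"
  assumes fin: "finite S" and w: "\<And>j. j \<in> S \<Longrightarrow> 0 \<le> w j"
    and q: "(\<Sum>j\<in>S. w j) = q" "0 < q"
    and i: "i \<in> S" "1 \<le> w i" and k: "k \<in> S" "1 \<le> w k"
  defines "m \<equiv> (\<Sum>j\<in>S. w j * z j) / q"
  shows "(z i - z k)\<^sup>2 / 2 \<le> (\<Sum>j\<in>S. w j * (z j - c)\<^sup>2) - q * (m - c)\<^sup>2"
proof -
  have mq: "(\<Sum>j\<in>S. w j * z j) = q * m" using q by (simp add: m_def)
  have "(\<Sum>j\<in>S. w j * (z j - c)\<^sup>2)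
      = (\<Sum>j\<in>S. w j * (z j - m)\<^sup>2 + 2 * (m - c) * (w j * z j) + (c\<^sup>2 - m\<^sup>2) * w j)"
    by (intro sum.cong refl) (simp add: power2_eq_square algebra_simps)
  also have "\<dots> = (\<Sum>j\<in>S. w j * (z j - m)\<^sup>2) + 2 * (m - c) * (q * m) + (c\<^sup>2 - m\<^sup>2) * q"
    by (simp add: sum.distrib sum_distrib_left[symmetric] mq q(1))
  finally have eq: "(\<Sum>j\<in>S. w j * (z j - c)\<^sup>2) - q * (m - c)\<^sup>2 = (\<Sum>j\<in>S. w j * (z j - m)\<^sup>2)"
    by (simp add: power2_eq_square algebra_simps)
  have "(z i - z k)\<^sup>2 / 2 \<le> (\<Sum>j\<in>S. w j * (z j - m)\<^sup>2)"
  proof (cases "i = k")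
    case True
    then show ?thesis using w by (simp add: sum_nonneg)
  next
    case False
    have "0 \<le> (z i + z k - 2 * m)\<^sup>2" by simp
    then have "(z i - z k)\<^sup>2 \<le> 2 * (1 * (z i - m)\<^sup>2 + 1 * (z k - m)\<^sup>2)"
      by (simp add: power2_eq_square algebra_simps)
    then have "(z i - z k)\<^sup>2 / 2 \<le> 1 * (z i - m)\<^sup>2 + 1 * (z k - m)\<^sup>2"
      by simp
    also have "\<dots> \<le> w i * (z i - m)\<^sup>2 + w k * (z k - m)\<^sup>2"
      using i k by (intro add_mono mult_right_mono) auto
    also have "\<dots> = (\<Sum>j\<in>{i,k}. w j * (z j - m)\<^sup>2)" using False by simp
    also have "\<dots> \<le> (\<Sum>j\<in>S. w j * (z j - m)\<^sup>2)"
      using fin i k w by (intro sum_mono2) auto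
    finally show ?thesis .
  qed
  then show ?thesis by (simp add: eq)
qed

text \<open>\<open>p\<close> is the number of gaps between neighbouring points of \<open>X\<close>.
  Beyond \<open>p\<close> the sequence is constant, which keeps it monotone on all of
  \<open>nat\<close> and gives gaps of index \<open>p\<close> or more the width 0.\<close>

lemma sorted_enumeration:
  fixes X :: "real set"
  assumes "finite X" "X \<noteq> {}"
  obtains y :: "nat \<Rightarrow> real" and p where "mono y" "p < card X"
    "\<And>i. i < p \<Longrightarrow> y i < y (Suc i)" "\<And>i. y i \<in> X"
    "\<And>z. z \<in> X \<Longrightarrow> y 0 \<le> z \<and> z \<le> y p"
    "\<And>i z. z \<in> X \<Longrightarrow> z \<le> y i \<or> y (Suc i) \<le> z"
proof -
  define xs where "xs = sorted_list_of_set X"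
  define p where "p = card X - 1"
  define y where "y i = xs ! min i p" for i
  have c: "card X > 0" using assms by (simp add: card_gt_0_iff)
  have len: "length xs = Suc p" using c by (simp add: xs_def p_def)
  have set: "set xs = X" using assms by (simp add: xs_def)
  have srt: "sorted_wrt (<) xs" by (simp add: xs_def)
  have mono: "mono y"
    unfolding mono_def y_def using srt len
    by (auto intro!: sorted_nth_mono strict_sorted_imp_sorted)
  have index: "\<exists>k\<le>p. z = y k" if "z \<in> X" for z
    using that len unfolding set[symmetric] in_set_conv_nth y_def by (metis less_Suc_eq_le min.absorb1)
  show ?thesis
  proof (rule that[of y p])
    show "p < card X" using c by (simp add: p_def)
    show "y i < y (Suc i)" if "i < p" for i
      using that len srt by (auto simp: y_def min_def intro: sorted_wrt_nth_less)
    show "y i \<in> X" for i using len set by (auto simp: y_def)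
    show "y 0 \<le> z \<and> z \<le> y p" if "z \<in> X" for z
      using index[OF that] mono by (auto simp: monoD)
    show "z \<le> y i \<or> y (Suc i) \<le> z" if z: "z \<in> X" for i z
    proof -
      obtain k where k: "z = y k" using index[OF z] by auto
      show ?thesis using mono k by (cases "k \<le> i") (auto simp: monoD not_le Suc_le_eq)
    qed
  qed (rule mono)
qed

section \<open>The averaging system and its closed subsystems\<close>

locale reversible_averaging =
  fixes n :: nat and \<rho> :: real and q :: "nat \<Rightarrow> real"
    and M :: "nat \<Rightarrow> nat \<Rightarrow> nat \<Rightarrow> real" and x :: "nat \<Rightarrow> nat \<Rightarrow> real"
  assumes sys: "rev_system n \<rho> q M"
    and x_Suc: "x (Suc t) i = (\<Sum>j<n. M t i j * x t j) / q i"
    and rho_pos: "0 < \<rho>"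
begin

text \<open>Such a set is a union of components of the graph at time \<open>t\<close>, so in this
  step its vertices average only among themselves.\<close>

definition closed_at :: "nat set \<Rightarrow> nat \<Rightarrow> bool" where
  "closed_at S t \<longleftrightarrow> S \<subseteq> {..<n} \<and> (\<forall>i\<in>S. \<forall>j<n. j \<notin> S \<longrightarrow> M t i j = 0)"

definition moment :: "nat set \<Rightarrow> real \<Rightarrow> nat \<Rightarrow> real" where
  "moment S c t = (\<Sum>i\<in>S. q i * (x t i - c)\<^sup>2)"

definition segments :: "nat set \<Rightarrow> nat \<Rightarrow> real set" where
  "segments S t = \<Union> {{min (x t i) (x t j) .. max (x t i) (x t j)} | i j.
     i \<in> S \<and> j \<in> S \<and> edge n M t i j \<and> i \<noteq> j}"

definition block_energy :: "real \<Rightarrow> nat set \<Rightarrow> nat \<Rightarrow> real" where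
  "block_energy s S t = (\<Sum>C\<in>components (segments S t). (Sup C - Inf C) powr s)"

text \<open>Reachability in the whole graph. A class that starts in a set closed at \<open>t\<close>
  never leaves it, so \<open>card (S // linked t)\<close> is the number of components of the
  subsystem on \<open>S\<close>.\<close>

definition linked :: "nat \<Rightarrow> (nat \<times> nat) set" where
  "linked t = {(i, j). (edge n M t)\<^sup>*\<^sup>* i j}"

lemma M_sym: "i < n \<Longrightarrow> j < n \<Longrightarrow> M t i j = M t j i"
  and M_nonneg: "i < n \<Longrightarrow> j < n \<Longrightarrow> 0 \<le> M t i j"
  and M_ge_1: "i < n \<Longrightarrow> j < n \<Longrightarrow> M t i j \<noteq> 0 \<Longrightarrow> 1 \<le> M t i j"
  and M_diag: "i < n \<Longrightarrow> 1 \<le> M t i i"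
  and M_row: "i < n \<Longrightarrow> (\<Sum>j<n. M t i j) = q i"
  and q_le: "i < n \<Longrightarrow> q i \<le> 1 / \<rho>"
  using sys unfolding rev_system_def by blast+

lemma q_ge_1: assumes "i < n" shows "1 \<le> q i"
proof -
  have "M 0 i i \<le> (\<Sum>j<n. M 0 i j)"
    using assms M_nonneg by (intro member_le_sum) auto
  then show ?thesis using M_diag[OF assms, of 0] M_row[OF assms, of 0] by simp
qed

lemma closed_at_finite: "closed_at S t \<Longrightarrow> finite S"
  by (auto simp: closed_at_def intro: finite_subset)

lemma closed_at_less: "closed_at S t \<Longrightarrow> i \<in> S \<Longrightarrow> i < n"
  by (auto simp: closed_at_def)

lemma closed_row_sum:
  assumes "closed_at S t" "i \<in> S"
  shows "(\<Sum>j\<in>S. M t i j * f j) = (\<Sum>j<n. M t i j * f j)"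
  using assms by (intro sum.mono_neutral_left) (auto simp: closed_at_def)

lemma closed_row: "closed_at S t \<Longrightarrow> i \<in> S \<Longrightarrow> (\<Sum>j\<in>S. M t i j) = q i"
  using closed_row_sum[of S t i "\<lambda>_. 1"] M_row[of i t] by (simp add: closed_at_less)

lemma closed_x_Suc:
  "closed_at S t \<Longrightarrow> i \<in> S \<Longrightarrow> x (Suc t) i = (\<Sum>j\<in>S. M t i j * x t j) / q i"
  by (simp add: x_Suc closed_row_sum)

text \<open>The new position of \<open>i\<close> is a convex combination of positions in
  \<open>S\<close>: row \<open>i\<close> restricted to the closed set still sums to
  \<open>q i\<close>.\<close>

lemma step_upper:
  assumes "closed_at S t" "\<And>j. j \<in> S \<Longrightarrow> x t j \<le> y" "i \<in> S"
  shows "x (Suc t) i \<le> y"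
proof -
  have "(\<Sum>j\<in>S. M t i j * x t j) \<le> (\<Sum>j\<in>S. M t i j * y)"
    using assms by (intro sum_mono mult_left_mono) (auto intro!: M_nonneg simp: closed_at_less)
  also have "\<dots> = q i * y" using closed_row[OF assms(1,3)] by (simp flip: sum_distrib_right)
  finally show ?thesis
    using q_ge_1[OF closed_at_less[OF assms(1,3)]]
    by (simp add: closed_x_Suc[OF assms(1,3)] divide_le_eq mult.commute)
qed

lemma step_lower:
  assumes "closed_at S t" "\<And>j. j \<in> S \<Longrightarrow> y \<le> x t j" "i \<in> S"
  shows "y \<le> x (Suc t) i"
proof -
  have "(\<Sum>j\<in>S. M t i j * y) \<le> (\<Sum>j\<in>S. M t i j * x t j)"
    using assms by (intro sum_mono mult_left_mono) (auto intro!: M_nonneg simp: closed_at_less)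
  moreover have "(\<Sum>j\<in>S. M t i j * y) = q i * y"
    using closed_row[OF assms(1,3)] by (simp flip: sum_distrib_right)
  ultimately show ?thesis
    using q_ge_1[OF closed_at_less[OF assms(1,3)]]
    by (simp add: closed_x_Suc[OF assms(1,3)] le_divide_eq mult.commute)
qed

lemma window_upper:
  assumes "\<And>t. a \<le> t \<Longrightarrow> t < b \<Longrightarrow> closed_at S t" "\<And>j. j \<in> S \<Longrightarrow> x a j \<le> y" "a \<le> t" "t \<le> b"
  shows "\<forall>j\<in>S. x t j \<le> y"
  using assms(3,4)
proof (induction t rule: dec_induct)
  case base show ?case using assms by blast
next
  case (step t) then show ?case using step_upper[of S t y] assms(1)[of t] by auto
qed

lemma window_lower:
  assumes "\<And>t. a \<le> t \<Longrightarrow> t < b \<Longrightarrow> closed_at S t" "\<And>j. j \<in> S \<Longrightarrow> y \<le> x a j" "a \<le> t" "t \<le> b"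
  shows "\<forall>j\<in>S. y \<le> x t j"
  using assms(3,4)
proof (induction t rule: dec_induct)
  case base show ?case using assms by blast
next
  case (step t) then show ?case using step_lower[of S t y] assms(1)[of t] by auto
qed

section \<open>The moment and its loss in one step\<close>

lemma moment_summand_nonneg: "i < n \<Longrightarrow> 0 \<le> q i * (x t i - c)\<^sup>2"
  using q_ge_1[of i] by simp

lemma moment_nonneg: "S \<subseteq> {..<n} \<Longrightarrow> 0 \<le> moment S c t"
  unfolding moment_def by (intro sum_nonneg moment_summand_nonneg) auto

lemma moment_mono: "T \<subseteq> S \<Longrightarrow> S \<subseteq> {..<n} \<Longrightarrow> moment T c t \<le> moment S c t"
  unfolding moment_def
  by (intro sum_mono2 moment_summand_nonneg) (auto intro: finite_subset)

lemma moment_ge_diff: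
  assumes "S \<subseteq> {..<n}" "i \<in> S" "k \<in> S"
  shows "(x t i - x t k)\<^sup>2 \<le> 2 * moment S c t"
proof (cases "i = k")
  case True then show ?thesis using moment_nonneg[OF assms(1)] by simp
next
  case False
  \<comment> \<open>This square is the difference of the two sides of the next inequality.\<close>
  have "0 \<le> (x t i + x t k - 2 * c)\<^sup>2" by simp
  then have "(x t i - x t k)\<^sup>2 \<le> 2 * (1 * (x t i - c)\<^sup>2 + 1 * (x t k - c)\<^sup>2)"
    by (simp add: power2_eq_square algebra_simps)
  also have "\<dots> \<le> 2 * (q i * (x t i - c)\<^sup>2 + q k * (x t k - c)\<^sup>2)"
    using assms q_ge_1 by (intro mult_left_mono add_mono mult_right_mono) auto
  also have "\<dots> = 2 * moment {i,k} c t" using False by (simp add: moment_def)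
  also have "\<dots> \<le> 2 * moment S c t" using moment_mono[of "{i,k}" S] assms by auto
  finally show ?thesis .
qed

lemma moment_le_diam:
  assumes "S \<subseteq> {..<n}" "\<And>i. i \<in> S \<Longrightarrow> lo \<le> x t i \<and> x t i \<le> hi" "lo \<le> c" "c \<le> hi"
  shows "moment S c t \<le> real n / \<rho> * (hi - lo)\<^sup>2"
proof -
  have "moment S c t \<le> (\<Sum>i\<in>S. 1 / \<rho> * (hi - lo)\<^sup>2)"
    unfolding moment_def
  proof (intro sum_mono mult_mono)
    fix i assume i: "i \<in> S"
    have "\<bar>x t i - c\<bar> \<le> \<bar>hi - lo\<bar>" using assms(2)[OF i] assms(3,4) by linarith
    then show "(x t i - c)\<^sup>2 \<le> (hi - lo)\<^sup>2" by (simp add: abs_le_square_iff)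
    show "q i \<le> 1 / \<rho>" using i assms q_le by auto
  qed (use rho_pos in auto)
  also have "\<dots> = real (card S) * (1 / \<rho> * (hi - lo)\<^sup>2)" by simp
  also have "\<dots> \<le> real n * (1 / \<rho> * (hi - lo)\<^sup>2)"
    using assms(1) rho_pos card_mono[of "{..<n}" S] by (intro mult_right_mono) auto
  finally show ?thesis by simp
qed

text \<open>Reversibility enters here: by symmetry the columns of \<open>M t\<close> on
  \<open>S\<close> also sum to \<open>q\<close>, so the moment at time \<open>t\<close> can be
  redistributed over the rows and compared with the new moment vertex by vertex.\<close>

lemma moment_drop_eq:
  assumes "closed_at S t"
  shows "moment S c t - moment S c (Suc t)
    = (\<Sum>i\<in>S. (\<Sum>j\<in>S. M t i j * (x t j - c)\<^sup>2) - q i * (x (Suc t) i - c)\<^sup>2)"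
proof -
  have "(\<Sum>i\<in>S. \<Sum>j\<in>S. M t i j * (x t j - c)\<^sup>2) = (\<Sum>j\<in>S. \<Sum>i\<in>S. M t j i * (x t j - c)\<^sup>2)"
    by (subst sum.swap) (intro sum.cong refl, use assms M_sym closed_at_less in metis)
  also have "\<dots> = moment S c t"
    unfolding moment_def using closed_row[OF assms] by (simp flip: sum_distrib_right)
  finally show ?thesis by (simp add: sum_subtractf moment_def)
qed

text \<open>The bound is \<open>q i\<close> times the variance of the positions under row
  \<open>i\<close>. The self-loop makes \<open>i\<close> one of the two points of weight at least 1;
  the neighbour \<open>k\<close> is the other.\<close>

lemma vertex_drop:
  assumes "closed_at S t" "i \<in> S" "k \<in> S" "M t i k \<noteq> 0"
  shows "(x t k - x t i)\<^sup>2 / 2 \<le> (\<Sum>j\<in>S. M t i j * (x t j - c)\<^sup>2) - q i * (x (Suc t) i - c)\<^sup>2"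
proof -
  note less = closed_at_less[OF assms(1)]
  show ?thesis
    unfolding closed_x_Suc[OF assms(1,2)]
    using weighted_variance_ge[OF closed_at_finite[OF assms(1)], of "M t i" "q i" k i "x t" c]
      less assms M_nonneg M_ge_1 M_diag closed_row[OF assms(1,2)] q_ge_1[of i]
    by fastforce
qed

text \<open>Each gap is charged to the lower endpoint of an edge crossing it. All gaps charged to
  one vertex \<open>v\<close> lie between \<open>v\<close> and a single neighbour, so their squares
  sum to at most the squared distance to that neighbour, half of which \<open>v\<close> loses. No
  vertex pays twice.\<close>

lemma step_drop:
  assumes cl: "closed_at S t" and y: "mono y" and fin: "finite I"
    and cross: "\<And>i. i \<in> I \<Longrightarrow> \<exists>v\<in>S. \<exists>w\<in>S. M t v w \<noteq> 0 \<and> x t v \<le> y i \<and> y (Suc i) \<le> x t w"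
  shows "(\<Sum>i\<in>I. (y (Suc i) - y i)\<^sup>2) / 2 \<le> moment S c t - moment S c (Suc t)"
proof -
  obtain f g where fg: "\<And>i. i \<in> I \<Longrightarrow> f i \<in> S \<and> g i \<in> S \<and> M t (f i) (g i) \<noteq> 0
      \<and> x t (f i) \<le> y i \<and> y (Suc i) \<le> x t (g i)"
    using cross by metis
  have "(\<Sum>i\<in>I. (y (Suc i) - y i)\<^sup>2) / 2 = (\<Sum>v\<in>S. (\<Sum>i | i \<in> I \<and> f i = v. (y (Suc i) - y i)\<^sup>2) / 2)"
    using fg closed_at_finite[OF cl] fin
    by (subst sum.group[of I S f, symmetric]) (auto simp: sum_divide_distrib)
  also have "\<dots> \<le> (\<Sum>v\<in>S. (\<Sum>j\<in>S. M t v j * (x t j - c)\<^sup>2) - q v * (x (Suc t) v - c)\<^sup>2)"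
  proof (rule sum_mono)
    fix v assume v: "v \<in> S"
    define J where "J = {i. i \<in> I \<and> f i = v}"
    show "(\<Sum>i | i \<in> I \<and> f i = v. (y (Suc i) - y i)\<^sup>2) / 2
      \<le> (\<Sum>j\<in>S. M t v j * (x t j - c)\<^sup>2) - q v * (x (Suc t) v - c)\<^sup>2"
    proof (cases "J = {}")
      case True
      \<comment> \<open>A vertex without charged gaps still must not gain: the self-loop gives a
        loss of at least 0.\<close>
      have "M t v v \<noteq> 0" using M_diag[OF closed_at_less[OF cl v], of t] by auto
      then show ?thesis using vertex_drop[OF cl v v, of c] True unfolding J_def[symmetric] by simp
    next
      case False
      have finJ: "finite J" using fin by (simp add: J_def)
      have mx: "Max J \<in> J" and mn: "Min J \<in> J" using finJ False by auto
      \<comment> \<open>The neighbour reached across the highest charged gap lies above all the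
        others.\<close>
      define w where "w = g (Max J)"
      have w: "w \<in> S" "M t v w \<noteq> 0" "y (Suc (Max J)) \<le> x t w" "x t v \<le> y (Min J)"
        using fg[of "Max J"] fg[of "Min J"] mx mn by (auto simp: J_def w_def)
      have "(\<Sum>i\<in>J. (y (Suc i) - y i)\<^sup>2) \<le> (\<Sum>i\<in>J. y (Suc i) - y i)\<^sup>2"
        using finJ y by (intro sum_power2_le_power2_sum) (auto simp: monoD)
      also have "\<dots> \<le> (x t w - x t v)\<^sup>2"
        using sum_increments_le[OF y finJ False] w y
        by (intro power_mono sum_nonneg) (auto simp: monoD)
      finally show ?thesis using vertex_drop[OF cl v w(1,2), of c] by (simp add: J_def)
    qed
  qed
  also have "\<dots> = moment S c t - moment S c (Suc t)" by (simp add: moment_drop_eq[OF cl])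
  finally show ?thesis .
qed

lemma moment_decreasing:
  assumes "\<And>t. a \<le> t \<Longrightarrow> t < b \<Longrightarrow> closed_at S t" "a \<le> b"
  shows "moment S c b \<le> moment S c a"
  using assms(2,1)
proof (induction b rule: dec_induct)
  case (step t)
  then have "moment S c (Suc t) \<le> moment S c t"
    \<comment> \<open>With no gaps at all, the loss bound says that the moment does not
      grow.\<close>
    using step_drop[of S t "\<lambda>_. 0" "{}" c] by (auto simp: mono_def)
  then show ?case using step by force
qed simp

section \<open>Crossing of gaps and contraction of the moment\<close>

definition crossed :: "nat set \<Rightarrow> nat set \<Rightarrow> nat \<Rightarrow> bool" where
  "crossed S L t \<longleftrightarrow> (\<exists>v\<in>L. \<exists>w\<in>S - L. M t v w \<noteq> 0)"

text \<open>By symmetry of \<open>M t\<close>, excluding edges from \<open>L\<close> to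
  \<open>S - L\<close> excludes the reverse ones too, so both halves evolve independently in this
  step.\<close>

lemma not_crossed_closed:
  assumes "closed_at S t" "L \<subseteq> S" "\<not> crossed S L t"
  shows "closed_at L t" "closed_at (S - L) t"
proof -
  show "closed_at L t"
    using assms unfolding closed_at_def crossed_def by blast
  have "M t i j = 0" if "i \<in> S - L" "j < n" "j \<notin> S - L" for i j
  proof (cases "j \<in> S")
    case True
    then have "M t j i = 0" using assms(3) that by (auto simp: crossed_def)
    then show ?thesis using M_sym[of i j t] that closed_at_less[OF assms(1)] by auto
  next
    case False
    then show ?thesis using assms(1) that by (auto simp: closed_at_def)
  qed
  then show "closed_at (S - L) t"
    using assms(1) by (auto simp: closed_at_def)
qed

text \<open>Each gap is charged to the first time at which its cut is crossed. Until then both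
  halves are closed and stay on their sides of the gap, so the crossing edge spans the whole gap of
  time \<open>a\<close>. Summing the one-step losses over the window telescopes.\<close>

lemma phase_drop:
  assumes cl: "\<And>t. a \<le> t \<Longrightarrow> t < b \<Longrightarrow> closed_at S t" and y: "mono y" and ab: "a \<le> b"
    and gap: "\<And>i v. i < p \<Longrightarrow> v \<in> S \<Longrightarrow> x a v \<le> y i \<or> y (Suc i) \<le> x a v"
    and cross: "\<And>i. i < p \<Longrightarrow> \<exists>t. a \<le> t \<and> t < b \<and> crossed S {v\<in>S. x a v \<le> y i} t"
  shows "(\<Sum>i<p. (y (Suc i) - y i)\<^sup>2) / 2 \<le> moment S c a - moment S c b"
proof -
  \<comment> \<open>The cuts are vertex sets frozen at time \<open>a\<close>; they do not follow
    later reorderings.\<close>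
  define L where "L = (\<lambda>i. {v\<in>S. x a v \<le> y i})"
  define \<tau> where "\<tau> i = (LEAST t. a \<le> t \<and> crossed S (L i) t)" for i
  have tau: "a \<le> \<tau> i" "crossed S (L i) (\<tau> i)" "\<tau> i < b"
    and tau_min: "\<And>t. a \<le> t \<Longrightarrow> t < \<tau> i \<Longrightarrow> \<not> crossed S (L i) t" if i: "i < p" for i
  proof -
    obtain t where t: "a \<le> t" "t < b" "crossed S (L i) t" using cross[OF i] by (auto simp: L_def)
    show "a \<le> \<tau> i" "crossed S (L i) (\<tau> i)"
      unfolding \<tau>_def using LeastI[of "\<lambda>t. a \<le> t \<and> crossed S (L i) t" t] t by auto
    show "\<tau> i < b"
      unfolding \<tau>_def using Least_le[of "\<lambda>t. a \<le> t \<and> crossed S (L i) t" t] t by auto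
    show "\<not> crossed S (L i) t" if "a \<le> t" "t < \<tau> i" for t
      using that not_less_Least[of t "\<lambda>t. a \<le> t \<and> crossed S (L i) t"] by (auto simp: \<tau>_def)
  qed
  have sub: "L i \<subseteq> S" for i by (auto simp: L_def)
  have "(\<Sum>i<p. (y (Suc i) - y i)\<^sup>2) / 2
      = (\<Sum>t\<in>{a..<b}. (\<Sum>i | i \<in> {..<p} \<and> \<tau> i = t. (y (Suc i) - y i)\<^sup>2) / 2)"
    using tau by (subst sum.group[of "{..<p}" "{a..<b}" \<tau>, symmetric]) (auto simp: sum_divide_distrib)
  also have "\<dots> \<le> (\<Sum>t\<in>{a..<b}. moment S c t - moment S c (Suc t))"
  proof (intro sum_mono step_drop)
    fix t i assume t: "t \<in> {a..<b}" and "i \<in> {i. i \<in> {..<p} \<and> \<tau> i = t}"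
    then have i: "i < p" "\<tau> i = t" by auto
    \<comment> \<open>Closedness strictly before \<open>t\<close> suffices: the positions at time
      \<open>t\<close> precede the averaging by the crossing edge.\<close>
    have "closed_at (L i) t'" "closed_at (S - L i) t'" if "a \<le> t'" "t' < t" for t'
      using not_crossed_closed[OF cl sub tau_min[OF i(1)]] that t i by auto
    then have "\<forall>v\<in>L i. x t v \<le> y i" "\<forall>v\<in>S - L i. y (Suc i) \<le> x t v"
      using gap[OF i(1)] t
      by (intro window_upper[where a = a and b = t] window_lower[where a = a and b = t]; force simp: L_def)+
    then show "\<exists>v\<in>S. \<exists>w\<in>S. M t v w \<noteq> 0 \<and> x t v \<le> y i \<and> y (Suc i) \<le> x t w"
      using tau(2)[OF i(1)] i(2) sub unfolding crossed_def by blast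
  qed (use cl y in auto)
  also have "\<dots> = - (\<Sum>t\<in>{a..<b}. moment S c (Suc t) - moment S c t)"
    by (simp flip: sum_negf)
  also have "\<dots> = moment S c a - moment S c b"
    using ab by (simp add: sum_Suc_diff')
  finally show ?thesis .
qed

text \<open>The absolute loss, at least the squared diameter over \<open>2 * n\<close>, becomes a
  relative one because the moment is at most \<open>n / \<rho>\<close> times the squared diameter.
  The latter holds since \<open>c\<close> lies within the range of the positions.\<close>

lemma contraction:
  assumes cl: "\<And>t. a \<le> t \<Longrightarrow> t < b \<Longrightarrow> closed_at S t" and y: "mono y" and ab: "a \<le> b"
    and S: "S \<subseteq> {..<n}" and n: "0 < n" and p: "p \<le> n"
    and gap: "\<And>i v. i < p \<Longrightarrow> v \<in> S \<Longrightarrow> x a v \<le> y i \<or> y (Suc i) \<le> x a v"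
    and cross: "\<And>i. i < p \<Longrightarrow> \<exists>t. a \<le> t \<and> t < b \<and> crossed S {v\<in>S. x a v \<le> y i} t"
    and range: "\<And>v. v \<in> S \<Longrightarrow> y 0 \<le> x a v \<and> x a v \<le> y p" and c: "y 0 \<le> c" "c \<le> y p"
  shows "moment S c b \<le> (1 - \<rho> / (2 * real n ^ 2)) * moment S c a"
proof -
  have "(y p - y 0)\<^sup>2 = (\<Sum>i<p. y (Suc i) - y i)\<^sup>2" by (simp add: sum_lessThan_telescope)
  also have "\<dots> \<le> (\<Sum>i<p. (y (Suc i) - y i)\<^sup>2) * real p"
    using sum_squared_le_sum_of_squares[of "\<lambda>i. y (Suc i) - y i" "{..<p}"] by simp
  also have "\<dots> \<le> (\<Sum>i<p. (y (Suc i) - y i)\<^sup>2) * real n"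
    using p by (intro mult_left_mono sum_nonneg) auto
  also have "\<dots> \<le> 2 * (moment S c a - moment S c b) * real n"
    using phase_drop[where c = c and p = p, OF cl y ab gap cross] by (intro mult_right_mono) auto
  finally have d: "(y p - y 0)\<^sup>2 \<le> 2 * (moment S c a - moment S c b) * real n" .
  have "moment S c a \<le> real n / \<rho> * (y p - y 0)\<^sup>2"
    using moment_le_diam[OF S range c] by simp
  also have "\<dots> \<le> real n / \<rho> * (2 * (moment S c a - moment S c b) * real n)"
    using d rho_pos by (intro mult_left_mono) auto
  finally have "moment S c a * \<rho> \<le> 2 * real n ^ 2 * (moment S c a - moment S c b)"
    using rho_pos by (simp add: field_simps power2_eq_square)
  then have "moment S c a * \<rho> / (2 * real n ^ 2) \<le> moment S c a - moment S c b"
    using n by (simp add: divide_le_eq mult.commute)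
  then show ?thesis by (simp add: algebra_simps)
qed

section \<open>Blocks, their number and their lengths\<close>

lemma segments_subset:
  assumes "\<And>i. i \<in> S \<Longrightarrow> lo \<le> x t i \<and> x t i \<le> hi"
  shows "segments S t \<subseteq> {lo..hi}"
proof
  fix z assume "z \<in> segments S t"
  then obtain i j where ij: "i \<in> S" "j \<in> S" "min (x t i) (x t j) \<le> z" "z \<le> max (x t i) (x t j)"
    by (auto simp: segments_def)
  then show "z \<in> {lo..hi}" using assms[of i] assms[of j] by (auto simp: min_def max_def split: if_splits)
qed

lemma segment_in_segments:
  "i \<in> S \<Longrightarrow> j \<in> S \<Longrightarrow> edge n M t i j \<Longrightarrow> i \<noteq> j \<Longrightarrow>
    {min (x t i) (x t j) .. max (x t i) (x t j)} \<subseteq> segments S t"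
  unfolding segments_def by blast

lemma closed_at_edge: "closed_at S t \<Longrightarrow> i \<in> S \<Longrightarrow> edge n M t i j \<Longrightarrow> j \<in> S"
  by (auto simp: closed_at_def edge_def)

text \<open>Consecutive vertices of a path are joined by the segment of their edge. The condition on
  \<open>x t i\<close> accounts for isolated vertices, which span no segment.\<close>

lemma linked_connected:
  assumes "(edge n M t)\<^sup>*\<^sup>* i j" "closed_at S t" "i \<in> S"
  shows "j \<in> S \<and> (x t i \<in> segments S t \<longrightarrow> connected_component (segments S t) (x t i) (x t j))"
  using assms(1)
proof (induction rule: rtranclp_induct)
  case base then show ?case using assms by auto
next
  case (step j k)
  then have j: "j \<in> S" and k: "k \<in> S" using closed_at_edge[OF assms(2)] by auto
  have "connected_component (segments S t) (x t j) (x t k)" if "j \<noteq> k"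
    using segment_in_segments[OF j k step(2) that] unfolding connected_component_def
    by (intro exI[of _ "{min (x t j) (x t k) .. max (x t j) (x t k)}"]) auto
  then show ?case using step k by (metis connected_component_trans)
qed

text \<open>Each block contains the position of some vertex. Sending a block to the class of such a
  vertex is injective, as linked vertices cannot represent different blocks.\<close>

lemma card_blocks_le:
  assumes cl: "closed_at S t"
  shows "finite (components (segments S t))"
    and "card (components (segments S t)) \<le> card (S // linked t)"
proof -
  have ex: "\<exists>i. i \<in> S \<and> x t i \<in> C" if C: "C \<in> components (segments S t)" for C
  proof -
    obtain z where z: "z \<in> C" "z \<in> segments S t"
      using C in_components_nonempty in_components_subset by blast
    then obtain i j where ij: "i \<in> S" "j \<in> S" "edge n M t i j" "i \<noteq> j"
      "z \<in> {min (x t i) (x t j) .. max (x t i) (x t j)}"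
      unfolding segments_def by blast
    have "{min (x t i) (x t j) .. max (x t i) (x t j)} \<subseteq> C"
      using z ij by (intro components_maximal[OF C] segment_in_segments) auto
    then show ?thesis using ij(1) by (auto intro!: exI[of _ i])
  qed
  define rep where "rep C = (SOME i. i \<in> S \<and> x t i \<in> C)" for C
  have rep: "rep C \<in> S" "x t (rep C) \<in> C" if "C \<in> components (segments S t)" for C
    using someI_ex[OF ex[OF that]] by (auto simp: rep_def)
  have inj: "inj_on (\<lambda>C. linked t `` {rep C}) (components (segments S t))"
  proof (rule inj_onI)
    fix C C' assume C: "C \<in> components (segments S t)" and C': "C' \<in> components (segments S t)"
      and eq: "linked t `` {rep C} = linked t `` {rep C'}"
    have "rep C' \<in> linked t `` {rep C}" unfolding eq by (simp add: linked_def)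
    then have "connected_component (segments S t) (x t (rep C)) (x t (rep C'))"
      using linked_connected[of t "rep C" "rep C'" S] cl rep[OF C] in_components_subset[OF C]
      by (auto simp: linked_def)
    then obtain T where T: "connected T" "T \<subseteq> segments S t" "x t (rep C) \<in> T" "x t (rep C') \<in> T"
      unfolding connected_component_def by blast
    have "T \<subseteq> C" using T rep[OF C] by (intro components_maximal[OF C]) auto
    then have "C \<inter> C' \<noteq> {}" using T rep[OF C'] by blast
    then show "C = C'" using components_eq[OF C C'] by blast
  qed
  have sub: "(\<lambda>C. linked t `` {rep C}) ` components (segments S t) \<subseteq> S // linked t"
    using rep by (auto intro: quotientI)
  have fin: "finite (S // linked t)"
    using closed_at_finite[OF cl] by (auto simp: quotient_def)
  show "finite (components (segments S t))" using inj_on_finite[OF inj sub fin] .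
  show "card (components (segments S t)) \<le> card (S // linked t)"
    using card_inj_on_le[OF inj sub fin] .
qed

lemma block_energy_nonneg: "0 \<le> block_energy s S t"
  unfolding block_energy_def by (intro sum_nonneg) auto

text \<open>No block is longer than the diameter, whose square is at most twice the moment; the
  factor \<open>2 powr (s / 2)\<close> is rounded up to 2.\<close>

lemma block_energy_le:
  assumes cl: "closed_at S t" and s: "0 < s" "s \<le> 1"
  shows "block_energy s S t \<le> real (card (S // linked t)) * (2 * moment S c t powr (s / 2))"
proof -
  have S: "S \<subseteq> {..<n}" using cl by (simp add: closed_at_def)
  have len: "(Sup C - Inf C) powr s \<le> 2 * moment S c t powr (s / 2)"
    if C: "C \<in> components (segments S t)" for C
  proof -
    have ne: "C \<noteq> {}" and sub: "C \<subseteq> segments S t"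
      using C by (auto simp: in_components_nonempty in_components_subset)
    then have "S \<noteq> {}" by (auto simp: segments_def)
    then have X: "finite (x t ` S)" "x t ` S \<noteq> {}" using closed_at_finite[OF cl] by auto
    then obtain u w where uw: "u \<in> S" "x t u = Min (x t ` S)" "w \<in> S" "x t w = Max (x t ` S)"
      by (metis Max_in Min_in imageE)
    have CC: "C \<subseteq> {x t u..x t w}"
      using sub segments_subset[of S "x t u" t "x t w"] X uw by force
    have bdd: "bdd_below C" "bdd_above C" using CC by (meson bdd_below_Icc bdd_above_Icc bdd_below_mono bdd_above_mono)+
    have "Sup C \<le> x t w" using ne CC by (intro cSup_least) auto
    moreover have "x t u \<le> Inf C" using ne CC by (intro cInf_greatest) auto
    ultimately have l: "0 \<le> Sup C - Inf C" "Sup C - Inf C \<le> x t w - x t u"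
      using cInf_le_cSup[OF ne bdd(2,1)] by auto
    have "(Sup C - Inf C)\<^sup>2 \<le> (x t w - x t u)\<^sup>2" using l by (intro power_mono) auto
    also have "\<dots> \<le> 2 * moment S c t" using moment_ge_diff[OF S uw(3,1)] .
    finally have sq: "(Sup C - Inf C)\<^sup>2 \<le> 2 * moment S c t" .
    have "(Sup C - Inf C) powr s = ((Sup C - Inf C)\<^sup>2) powr (s / 2)"
      using l(1) by (cases "Sup C = Inf C") (auto simp: powr_powr simp flip: powr_numeral)
    also have "\<dots> \<le> (2 * moment S c t) powr (s / 2)"
      using sq s by (intro powr_mono2) auto
    also have "\<dots> = 2 powr (s / 2) * moment S c t powr (s / 2)"
      using moment_nonneg[OF S] by (simp add: powr_mult)
    also have "\<dots> \<le> 2 powr 1 * moment S c t powr (s / 2)"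
      using s by (intro mult_right_mono powr_mono) auto
    finally show ?thesis by simp
  qed
  have "block_energy s S t \<le> real (card (components (segments S t))) * (2 * moment S c t powr (s / 2))"
    unfolding block_energy_def using len by (rule sum_bounded_above)
  also have "\<dots> \<le> real (card (S // linked t)) * (2 * moment S c t powr (s / 2))"
    using card_blocks_le(2)[OF cl] by (intro mult_right_mono) auto
  finally show ?thesis .
qed

text \<open>No edge joins the two closed sets, and the empty interval between \<open>y\<close> and
  \<open>y'\<close> keeps their segments apart, so each block of the union is a block of one of the
  halves.\<close>

lemma block_energy_split:
  assumes L: "closed_at L t" and R: "closed_at R t"
    and "\<And>v. v \<in> L \<Longrightarrow> x t v \<le> y" "\<And>v. v \<in> R \<Longrightarrow> y' \<le> x t v" "y < y'"
  shows "block_energy s (L \<union> R) t \<le> block_energy s L t + block_energy s R t"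
proof -
  have "segments (L \<union> R) t = segments L t \<union> segments R t"
  proof
    show "segments (L \<union> R) t \<subseteq> segments L t \<union> segments R t"
    proof
      fix z assume "z \<in> segments (L \<union> R) t"
      then obtain i j where ij: "i \<in> L \<union> R" "edge n M t i j" "i \<noteq> j"
        "z \<in> {min (x t i) (x t j) .. max (x t i) (x t j)}"
        unfolding segments_def by blast
      then have "i \<in> L \<and> j \<in> L \<or> i \<in> R \<and> j \<in> R"
        using closed_at_edge[OF L] closed_at_edge[OF R] by blast
      then show "z \<in> segments L t \<union> segments R t"
        using ij segment_in_segments[of i _ j t] by blast
    qed
    show "segments L t \<union> segments R t \<subseteq> segments (L \<union> R) t"
      unfolding segments_def by blast
  qed
  moreover have "segments L t \<subseteq> {..y}"
  proof
    fix z assume "z \<in> segments L t"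
    then obtain i j where "i \<in> L" "j \<in> L" "z \<le> max (x t i) (x t j)" by (auto simp: segments_def)
    then show "z \<in> {..y}" using assms(3)[of i] assms(3)[of j] by auto
  qed
  moreover have "segments R t \<subseteq> {y'..}"
  proof
    fix z assume "z \<in> segments R t"
    then obtain i j where "i \<in> R" "j \<in> R" "min (x t i) (x t j) \<le> z" by (auto simp: segments_def)
    then show "z \<in> {y'..}" using assms(4)[of i] assms(4)[of j] by auto
  qed
  ultimately show ?thesis
    unfolding block_energy_def
    using components_Un_separated_subset[of "segments L t" y "segments R t" y'] assms(5)
    by (intro sum_Un_le card_blocks_le(1)[OF L] card_blocks_le(1)[OF R]) auto
qed

section \<open>Recursion on the number of components\<close>

lemma card_quotient_split:
  assumes L: "closed_at L t" and R: "closed_at R t" and "L \<inter> R = {}"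
  shows "card ((L \<union> R) // linked t) = card (L // linked t) + card (R // linked t)"
proof -
  have "(L // linked t) \<inter> (R // linked t) = {}"
  proof (rule ccontr)
    assume "\<not> ?thesis"
    then obtain u v where uv: "u \<in> L" "v \<in> R" "linked t `` {u} = linked t `` {v}"
      by (auto simp: quotient_def)
    have "v \<in> linked t `` {u}" unfolding uv(3) by (simp add: linked_def)
    then have "v \<in> L" using linked_connected[of t u v L] L uv by (auto simp: linked_def)
    then show False using uv assms by blast
  qed
  moreover have "finite (L // linked t)" "finite (R // linked t)"
    using closed_at_finite[OF L] closed_at_finite[OF R] by (auto simp: quotient_def)
  moreover have "(L \<union> R) // linked t = (L // linked t) \<union> (R // linked t)"
    by (auto simp: quotient_def)
  ultimately show ?thesis by (simp add: card_Un_disjoint)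
qed

lemma card_quotient_pos:
  "closed_at S t \<Longrightarrow> S \<noteq> {} \<Longrightarrow> 1 \<le> card (S // linked t)"
  using closed_at_finite[of S t] by (auto simp: quotient_def Suc_le_eq card_gt_0_iff)

text \<open>While the cut \<open>L\<close> is uncrossed, both halves are closed and nonempty. Each
  uses up at least one component, leaving at most \<open>k\<close> to the other, so the bound for
  \<open>k\<close> applies to both. Bounding either moment by that of \<open>S\<close> yields the
  factor 2.\<close>

lemma split_window:
  assumes IH: "\<And>T. T \<subseteq> S \<Longrightarrow>
      (\<And>t. a \<le> t \<Longrightarrow> t < b \<Longrightarrow> closed_at T t \<and> card (T // linked t) \<le> k) \<Longrightarrow>
      (\<Sum>t\<in>{a..<b}. block_energy s T t) \<le> K * moment T c a powr (s / 2)"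
    and cl: "\<And>t. a \<le> t \<Longrightarrow> t < b \<Longrightarrow> closed_at S t \<and> card (S // linked t) \<le> Suc k"
    and S: "S \<subseteq> {..<n}" and s: "0 < s" and K: "0 \<le> K"
    and nc: "\<And>t. a \<le> t \<Longrightarrow> t < b \<Longrightarrow> \<not> crossed S L t"
    and L: "L \<subseteq> S" "L \<noteq> {}" "S - L \<noteq> {}"
    and sep: "\<And>v. v \<in> L \<Longrightarrow> x a v \<le> y" "\<And>v. v \<in> S - L \<Longrightarrow> y' \<le> x a v" "y < y'"
  shows "(\<Sum>t\<in>{a..<b}. block_energy s S t) \<le> 2 * K * moment S c a powr (s / 2)"
proof -
  define R where "R = S - L"
  have SLR: "S = L \<union> R" "L \<inter> R = {}" using L by (auto simp: R_def)
  have clLR: "closed_at L t" "closed_at R t" if "a \<le> t" "t < b" for t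
    using not_crossed_closed[of S t L] cl nc L that by (auto simp: R_def)
  have card: "card (L // linked t) \<le> k" "card (R // linked t) \<le> k" if "a \<le> t" "t < b" for t
    using card_quotient_split[OF clLR[OF that] SLR(2)] cl[OF that]
      card_quotient_pos[OF clLR(1)[OF that]] card_quotient_pos[OF clLR(2)[OF that]] L
    unfolding SLR(1)[symmetric] by (auto simp: R_def)
  have "(\<Sum>t\<in>{a..<b}. block_energy s S t)
      \<le> (\<Sum>t\<in>{a..<b}. block_energy s L t + block_energy s R t)"
  proof (rule sum_mono)
    fix t assume t: "t \<in> {a..<b}"
    have "\<forall>v\<in>L. x t v \<le> y"
      by (rule window_upper[where a = a and b = b]) (use clLR sep t in auto)
    moreover have "\<forall>v\<in>R. y' \<le> x t v"
      by (rule window_lower[where a = a and b = b]) (use clLR sep t in \<open>auto simp: R_def\<close>)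
    ultimately show "block_energy s S t \<le> block_energy s L t + block_energy s R t"
      using block_energy_split[of L t R y y' s] clLR[of t] t sep(3) SLR by auto
  qed
  also have "\<dots> = (\<Sum>t\<in>{a..<b}. block_energy s L t) + (\<Sum>t\<in>{a..<b}. block_energy s R t)"
    by (rule sum.distrib)
  also have "\<dots> \<le> K * moment L c a powr (s / 2) + K * moment R c a powr (s / 2)"
    by (intro add_mono IH) (use SLR clLR card in auto)
  also have "\<dots> \<le> K * moment S c a powr (s / 2) + K * moment S c a powr (s / 2)"
    using S K s SLR L
    by (intro add_mono mult_left_mono powr_mono2 moment_mono moment_nonneg) auto
  finally show ?thesis by simp
qed

text \<open>The reference point \<open>c\<close> is arbitrary, so that the same one serves both halves and all
  later times; clamping it to the range of the positions does not increase the moment.\<close>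

lemma energy_window:
  assumes s: "0 < s" "s \<le> 1" and n: "0 < n" and rho: "\<rho> \<le> 1 / 2"
  defines "B \<equiv> 16 * real n ^ 2 / (\<rho> * s)"
  assumes "\<And>t. a \<le> t \<Longrightarrow> t < b \<Longrightarrow> closed_at S t \<and> card (S // linked t) \<le> k" "S \<subseteq> {..<n}"
  shows "(\<Sum>t\<in>{a..<b}. block_energy s S t) \<le> B ^ k * moment S c a powr (s / 2)"
  using assms(6,7)
proof (induction k arbitrary: S a b c)
  case 0
  show ?case
  proof (cases "a < b")
    case True
    \<comment> \<open>A nonempty closed set has at least one component.\<close>
    then have "S = {}" using 0(1)[of a] card_quotient_pos[of S a] by fastforce
    then show ?thesis by (simp add: block_energy_def segments_def moment_def)
  qed simp
next
  case (Suc k)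
  have n1: "1 \<le> real n ^ 2" using n by (intro one_le_power) simp
  have "\<rho> * s \<le> 1 * 1" using s rho rho_pos by (intro mult_mono) auto
  then have "\<rho> * s * 2 \<le> 16 * real n ^ 2" using n1 by linarith
  then have B2: "2 \<le> B" using s rho_pos by (simp add: B_def field_simps)
  \<comment> \<open>This later absorbs the number of blocks of a single step into
    \<open>B ^ k\<close>.\<close>
  have kB: "real (Suc k) \<le> B ^ k"
  proof -
    have "real (Suc k) \<le> 2 ^ k" by (metis Suc_leI less_exp of_nat_le_iff of_nat_numeral of_nat_power)
    also have "\<dots> \<le> B ^ k" using B2 by (intro power_mono) auto
    finally show ?thesis .
  qed
  show ?case using Suc.prems
  \<comment> \<open>After the contraction the same bound, with the same number of components, is
    applied to a shorter window. The finite horizon \<open>b\<close> allows induction on the length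
    in place of a recursion for a best constant not yet known to be finite.\<close>
  proof (induction "b - a" arbitrary: a c rule: less_induct)
    case less
    note cl = less.prems(1) and S = less.prems(2)
    show ?case
    proof (cases "a < b \<and> S \<noteq> {}")
      case False
      then show ?thesis using B2 by (auto simp: block_energy_def segments_def)
    next
      case True
      then have finS: "finite S" using S finite_subset by blast
      obtain y p where y: "mono y" "p < card (x a ` S)" "\<And>i. i < p \<Longrightarrow> y i < y (Suc i)"
        "\<And>i. y i \<in> x a ` S" "\<And>z. z \<in> x a ` S \<Longrightarrow> y 0 \<le> z \<and> z \<le> y p"
        "\<And>i z. z \<in> x a ` S \<Longrightarrow> z \<le> y i \<or> y (Suc i) \<le> z"
        using sorted_enumeration[of "x a ` S"] finS True by auto
      have "card (x a ` S) \<le> n"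
        using card_image_le[OF finS, of "x a"] card_mono[OF _ S] by simp
      then have pn: "p \<le> n" using y by simp
      define L where "L i = {v\<in>S. x a v \<le> y i}" for i
      have y0p: "y 0 \<le> y p" using y(1) by (simp add: monoD)
      define d where "d = max (y 0) (min (y p) c)"
      have d: "y 0 \<le> d" "d \<le> y p" using y0p by (auto simp: d_def)
      have "moment S d a \<le> moment S c a"
        unfolding moment_def
      proof (intro sum_mono mult_left_mono)
        fix i assume i: "i \<in> S"
        have "\<bar>x a i - d\<bar> \<le> \<bar>x a i - c\<bar>" using y(5)[of "x a i"] i by (auto simp: d_def)
        then show "(x a i - d)\<^sup>2 \<le> (x a i - c)\<^sup>2" by (simp add: abs_le_square_iff)
        show "0 \<le> q i" using q_ge_1[of i] i S by auto
      qed
      then have cd: "moment S d a powr (s / 2) \<le> moment S c a powr (s / 2)"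
        using s moment_nonneg[OF S] by (intro powr_mono2) auto
      define V where "V = moment S d a powr (s / 2)"
      have V0: "0 \<le> V" by (simp add: V_def)
      \<comment> \<open>The end \<open>b'\<close> is left open: it is \<open>b\<close> if some gap
        is never crossed, and the time of the last first crossing otherwise.\<close>
      have split: "(\<Sum>t\<in>{a..<b'}. block_energy s S t) \<le> 2 * B ^ k * V"
        if i: "i < p" "\<And>t. a \<le> t \<Longrightarrow> t < b' \<Longrightarrow> \<not> crossed S (L i) t" and b': "b' \<le> b" for i b'
        unfolding V_def
      proof (rule split_window[where k = k and L = "L i" and y = "y i" and y' = "y (Suc i)"])
        show "(\<Sum>t\<in>{a..<b'}. block_energy s T t) \<le> B ^ k * moment T d a powr (s / 2)"
          if "T \<subseteq> S" "\<And>t. a \<le> t \<Longrightarrow> t < b' \<Longrightarrow> closed_at T t \<and> card (T // linked t) \<le> k" for T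
          using Suc.IH[of a b' T d] that S by blast
        show "closed_at S t \<and> card (S // linked t) \<le> Suc k" if "a \<le> t" "t < b'" for t
          using cl that b' by simp
        obtain u w where "u \<in> S" "x a u = y i" "w \<in> S" "x a w = y (Suc i)"
          using y(4)[of i] y(4)[of "Suc i"] by force
        then show "L i \<noteq> {}" "S - L i \<noteq> {}" using y(3)[OF i(1)] by (force simp: L_def)+
        show "y (Suc i) \<le> x a v" if "v \<in> S - L i" for v
          using y(6)[of "x a v" i] that by (auto simp: L_def)
      qed (use i S s B2 y in \<open>auto simp: L_def\<close>)
      have "(\<Sum>t\<in>{a..<b}. block_energy s S t) \<le> B ^ Suc k * V"
      proof (cases "\<forall>i<p. \<exists>t. a \<le> t \<and> t < b \<and> crossed S (L i) t")
        case False
        then obtain i where i: "i < p" "\<And>t. a \<le> t \<Longrightarrow> t < b \<Longrightarrow> \<not> crossed S (L i) t" by blast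
        have "(\<Sum>t\<in>{a..<b}. block_energy s S t) \<le> 2 * B ^ k * V"
          by (rule split[OF i order_refl])
        also have "\<dots> \<le> B * B ^ k * V" using B2 V0 by (intro mult_right_mono) auto
        finally show ?thesis by simp
      next
        case all: True
        \<comment> \<open>\<open>T\<close> is the first time by which every gap has been crossed,
          \<open>T\<close> included. If all positions coincide, then \<open>p = 0\<close> and
          \<open>T = a\<close>.\<close>
        define P where "P = (\<lambda>T. a \<le> T \<and> (\<forall>i<p. \<exists>t. a \<le> t \<and> t \<le> T \<and> crossed S (L i) t))"
        define T where "T = (LEAST T. P T)"
        have Pb: "P (b - 1)" using all True unfolding P_def by fastforce
        have PT: "P T" unfolding T_def by (rule LeastI[of P, OF Pb])
        have "T \<le> b - 1" unfolding T_def by (rule Least_le[of P, OF Pb])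
        then have aT: "a \<le> T" "T < b" using PT True by (auto simp: P_def)
        have before: "(\<Sum>t\<in>{a..<T}. block_energy s S t) \<le> 2 * B ^ k * V"
        proof (cases "a = T")
          case True then show ?thesis using B2 V0 by simp
        next
          case False
          \<comment> \<open>By minimality of \<open>T\<close>, some gap is uncrossed throughout
            \<open>{a..<T}\<close>, so the decoupled bound holds there.\<close>
          then have "\<not> P (T - 1)" using not_less_Least[of "T - 1" P] aT by (auto simp: T_def[symmetric])
          then obtain i where i: "i < p" "\<And>t. a \<le> t \<Longrightarrow> t \<le> T - 1 \<Longrightarrow> \<not> crossed S (L i) t"
            using aT False unfolding P_def by auto
          show ?thesis by (rule split[OF i(1)]) (use i aT in auto)
        qed
        have clT: "closed_at S T" "card (S // linked T) \<le> Suc k" using cl aT by auto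
        have "moment S d T \<le> moment S d a" using moment_decreasing[of a T S d] cl aT by auto
        then have VT: "moment S d T powr (s / 2) \<le> V"
          unfolding V_def using s moment_nonneg[OF S] by (intro powr_mono2) auto
        \<comment> \<open>The step at \<open>T\<close> belongs to neither phase and is bounded
          crudely by its number of blocks and the moment, which has not grown since
          \<open>a\<close>.\<close>
        have "block_energy s S T \<le> real (card (S // linked T)) * (2 * moment S d T powr (s / 2))"
          by (rule block_energy_le[OF clT(1) s])
        also have "\<dots> \<le> B ^ k * (2 * V)"
          using clT(2) kB VT B2 by (intro mult_mono) auto
        finally have at: "block_energy s S T \<le> 2 * B ^ k * V" by simp
        define \<delta> where "\<delta> = \<rho> / (2 * real n ^ 2)"
        have "\<rho> < 2 * real n ^ 2" using rho n1 by linarith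
        then have \<delta>: "0 < \<delta>" "\<delta> < 1"
          using rho_pos n by (auto simp: \<delta>_def)
        have "moment S d (Suc T) \<le> (1 - \<delta>) * moment S d a"
          unfolding \<delta>_def
        proof (rule contraction[where y = y and p = p])
          show "\<exists>t. a \<le> t \<and> t < Suc T \<and> crossed S {v \<in> S. x a v \<le> y i} t" if "i < p" for i
            using PT that unfolding P_def L_def by (auto simp: less_Suc_eq_le)
        qed (use cl aT S n pn y d in auto)
        then have "moment S d (Suc T) powr (s / 2) \<le> ((1 - \<delta>) * moment S d a) powr (s / 2)"
          using s moment_nonneg[OF S] by (intro powr_mono2) auto
        also have "\<dots> = (1 - \<delta>) powr (s / 2) * V"
          using \<delta> moment_nonneg[OF S] by (simp add: powr_mult V_def)
        also have "\<dots> \<le> (1 - s / 2 * \<delta>) * V"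
          using s \<delta> V0 by (intro mult_right_mono bernoulli_powr_le) auto
        \<comment> \<open>Origin of the 16 in \<open>B\<close>: the contraction saves
          \<open>4 / B\<close> of \<open>B ^ Suc k * V\<close>, that is
          \<open>4 * B ^ k * V\<close>, which pays exactly for \<open>2 * B ^ k * V\<close> before
          \<open>T\<close> and as much at \<open>T\<close>.\<close>
        also have "s / 2 * \<delta> = 4 / B"
          using s rho_pos n by (simp add: \<delta>_def B_def field_simps)
        finally have contr: "moment S d (Suc T) powr (s / 2) \<le> (1 - 4 / B) * V" .
        have "(\<Sum>t\<in>{Suc T..<b}. block_energy s S t) \<le> B ^ Suc k * moment S d (Suc T) powr (s / 2)"
          using aT cl S by (intro less.hyps) auto
        also have "\<dots> \<le> B ^ Suc k * ((1 - 4 / B) * V)"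
          using contr B2 by (intro mult_left_mono) auto
        also have "\<dots> = B ^ Suc k * V - 4 * B ^ k * V"
          using B2 by (simp add: field_simps)
        finally have after: "(\<Sum>t\<in>{Suc T..<b}. block_energy s S t) \<le> B ^ Suc k * V - 4 * B ^ k * V" .
        have "(\<Sum>t\<in>{a..<b}. block_energy s S t) = (\<Sum>t\<in>{a..<T}. block_energy s S t)
            + block_energy s S T + (\<Sum>t\<in>{Suc T..<b}. block_energy s S t)"
          using aT sum.atLeastLessThan_concat[of a T b "block_energy s S"]
          by (simp add: sum.atLeast_Suc_lessThan)
        then show ?thesis using before at after by linarith
      qed
      also have "\<dots> \<le> B ^ Suc k * moment S c a powr (s / 2)"
        using cd B2 by (intro mult_left_mono) (auto simp: V_def)
      finally show ?thesis .
    qed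
  qed
qed

end

section \<open>From finite windows to the full energy\<close>

lemma energy_le:
  assumes sys: "rev_system n \<rho> q M" and "2 \<le> n" "0 < \<rho>" "\<rho> \<le> 1 / 2" "0 < s" "s \<le> 1"
    and comps: "\<And>t. num_components n M t \<le> m" and var: "scaled_variance n q x0 \<le> 1"
  shows "energy n q M x0 s \<le> ennreal ((16 * real n ^ 2 / (\<rho> * s)) ^ m)"
proof -
  interpret reversible_averaging n \<rho> q M "traj n q M x0"
    by unfold_locales (use assms in auto)
  \<comment> \<open>With the weighted mean as reference point, the moment at time 0 is the scaled
    variance.\<close>
  define c where "c = (\<Sum>i<n. q i * x0 i) / (\<Sum>i<n. q i)"
  define B where "B = (16 * real n ^ 2 / (\<rho> * s)) ^ m"
  have mom: "moment {..<n} c 0 \<le> 1"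
    using var by (simp add: scaled_variance_def moment_def c_def Let_def)
  have en: "energy_t n q M x0 s t = block_energy s {..<n} t" for t
  proof -
    have "edge_union n M t (traj n q M x0 t) = segments {..<n} t"
      unfolding edge_union_def segments_def edge_def by (rule arg_cong[of _ _ Union]) auto
    then show ?thesis by (simp add: energy_t_def block_energy_def)
  qed
  \<comment> \<open>All vertices together form a closed set at every time, so each window
    \<open>{0..<N}\<close> obeys the bound, uniformly in \<open>N\<close>.\<close>
  have partial: "(\<Sum>t<N. energy_t n q M x0 s t) \<le> B" for N
  proof -
    have "(\<Sum>t\<in>{0..<N}. block_energy s {..<n} t) \<le> B * moment {..<n} c 0 powr (s / 2)"
      unfolding B_def
    proof (rule energy_window)
      show "closed_at {..<n} t \<and> card ({..<n} // linked t) \<le> m" for t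
        using comps[of t] by (auto simp: closed_at_def num_components_def linked_def)
    qed (use assms in auto)
    also have "\<dots> \<le> B * 1"
      using mom moment_nonneg[of "{..<n}" c 0] assms
      by (intro mult_left_mono powr_le1) (auto simp: B_def)
    finally show ?thesis by (simp add: en lessThan_atLeast0)
  qed
  show ?thesis
    unfolding energy_def B_def[symmetric]
  proof (rule suminf_le_const)
    show "(\<Sum>t<N. ennreal (energy_t n q M x0 s t)) \<le> ennreal B" for N
      using partial[of N] by (subst sum_ennreal) (auto simp: en block_energy_nonneg intro: ennreal_leI)
  qed simp
qed

theorem theorem1:
  shows "\<exists>c::real. c > 0 \<and>
    (\<forall>n \<rho> m s. 2 \<le> n \<longrightarrow> 0 < \<rho> \<longrightarrow> \<rho> \<le> 1/2 \<longrightarrow> 1 \<le> m \<longrightarrow> m \<le> n - 1 \<longrightarrow>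
       0 < s \<longrightarrow> s \<le> 1 \<longrightarrow>
       E_REV n \<rho> m s \<le> ennreal ((c * real n ^ 2 / (\<rho> * s)) ^ m))"
  unfolding E_REV_def
  by (intro exI[of _ 16] conjI allI impI Sup_least) (auto intro: energy_le)

end
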